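(* Let $p\in(0,1)$. If $p<0.25$, then the projection $\mathrm{proj}_{(1,0,0)}(\mathcal M_p)$ of the random Menger sponge onto the $x$-axis does not contain an interval almost surely.
   Context: Projection: $\mathrm{proj}_{(1,0,0)}(x,y,z)=x$. "Interval" means nondegenerate interval. Random Menger sponge: let $T$ be the set of the $20$ vectors obtained from $\{0,\frac13,\frac23\}^3$ by removing the $7$ vectors having at least two coordinates equal to $\frac13$. Let $f_t(x)=\frac13x+t$ on $\mathbb R^3$ for $t\in T$, and $f_{t_1\dots t_n}=f_{t_1}\circ\dots\circ f_{t_n}$. Give each nonempty finite word over $T$ an independent Bernoulli($p$) label, and let $\mathcal E_n\subset T^n$ be the random set of words $t_1\dots t_n$ such that all of $t_1,\ t_1t_2,\dots,\ t_1\dots t_n$ have label $1$. Then $\mathcal M_p:=\bigcap_{n\ge1}\bigcup_{\mathbf t\in\mathcal E_n}f_{\mathbf t}([0,1]^3)$. *)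

theory Defs
  imports "HOL-Probability.Probability"
begin

definition menger_digits :: "(real^3) set" where
  "menger_digits =
     {t. (\<forall>i. t $ i \<in> {0, 1/3, 2/3}) \<and> \<not> 2 \<le> card {i. t $ i = 1/3}}"

definition menger_map :: "real^3 \<Rightarrow> real^3 \<Rightarrow> real^3" where
  "menger_map t x = (1/3) *\<^sub>R x + t"

definition menger_word_map :: "(real^3) list \<Rightarrow> real^3 \<Rightarrow> real^3" where
  "menger_word_map w = foldr (\<lambda>t g. menger_map t \<circ> g) w id"

definition menger_words :: "(real^3) list set" where
  "menger_words = {w. w \<noteq> [] \<and> set w \<subseteq> menger_digits}"

text \<open>
  The label of a word is a boolean, with \<^term>\<open>True\<close> standing for 1. Here \<open>L\<close> is one
  realisation of all the labels; only its values on \<^const>\<open>menger_words\<close> are used.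
\<close>

definition retained_words :: "((real^3) list \<Rightarrow> bool) \<Rightarrow> nat \<Rightarrow> (real^3) list set" where
  "retained_words L n =
     {w. length w = n \<and> set w \<subseteq> menger_digits \<and> (\<forall>k\<in>{1..n}. L (take k w))}"

definition menger_sponge :: "((real^3) list \<Rightarrow> bool) \<Rightarrow> (real^3) set" where
  "menger_sponge L = (\<Inter>n\<in>{1..}. \<Union>w\<in>retained_words L n. menger_word_map w ` cbox 0 1)"

definition proj_100 :: "real^3 \<Rightarrow> real" where
  "proj_100 v = v $ 1"

definition nondegenerate_interval :: "real set \<Rightarrow> bool" where
  "nondegenerate_interval I \<longleftrightarrow> is_interval I \<and> (\<exists>a\<in>I. \<exists>b\<in>I. a \<noteq> b)"

end

(*
  For a point x = (k + 1/2) / 3^n the ternary expansion is unique and eventually constant 1, and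
  only 4 of the 20 digits project to 1/3. Hence at most C * 4^N words of length N have a cube
  meeting the plane over x; each is retained with probability p^N, and C * (4p)^N tends to 0. So x
  is almost surely outside the projection. These points are countable and dense.
*)

theory Submission
  imports Defs
begin

section \<open>Digits of the sponge and those projecting to 1/3\<close>

lemma finite_menger_digits: "finite menger_digits"
proof -
  have "menger_digits \<subseteq> vec_lambda ` (UNIV \<rightarrow>\<^sub>E {0, 1/3, 2/3})"
  proof
    fix t assume "t \<in> menger_digits"
    then have "($) t \<in> UNIV \<rightarrow>\<^sub>E {0, 1/3, 2/3}"
      by (auto simp: menger_digits_def PiE_UNIV_domain)
    then show "t \<in> vec_lambda ` (UNIV \<rightarrow>\<^sub>E {0, 1/3, 2/3})"
      by (metis image_eqI vec_nth_inverse)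
  qed
  then show ?thesis
    by (rule finite_subset) (simp add: finite_PiE)
qed

text \<open>A coordinate 1/3 in first place forbids another one, so each of the other two
  coordinates is 0 or 2/3. This 4 is the growth rate that is later played against
  \<open>p < 1/4\<close>.\<close>

lemma card_middle_digits_le: "card {t \<in> menger_digits. t $ 1 = 1/3} \<le> 4"
proof -
  let ?A = "{0, 2/3} :: real set"
  have "{t \<in> menger_digits. t $ 1 = 1/3} \<subseteq> (\<lambda>(a, b). vector [1/3, a, b]) ` (?A \<times> ?A)"
  proof
    fix t :: "real^3"
    assume "t \<in> {t \<in> menger_digits. t $ 1 = 1/3}"
    then have one: "t $ 1 = 1/3" and dig: "\<And>i. t $ i \<in> {0, 1/3, 2/3}"
      and cd: "\<not> 2 \<le> card {i. t $ i = 1/3}"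
      by (auto simp: menger_digits_def)
    have "t $ i \<in> ?A" if "i \<noteq> 1" for i
    proof (rule ccontr)
      assume "t $ i \<notin> ?A"
      with dig[of i] have "{1, i} \<subseteq> {i. t $ i = 1/3}"
        using one by auto
      then have "card {1, i} \<le> card {i. t $ i = 1/3}"
        by (intro card_mono) auto
      with cd that show False by simp
    qed
    then have "t $ 2 \<in> ?A" "t $ 3 \<in> ?A" by simp_all
    then have "(t $ 2, t $ 3) \<in> ?A \<times> ?A" by blast
    moreover have "t = vector [1/3, t $ 2, t $ 3]"
      using one by (simp add: vec_eq_iff forall_3)
    ultimately show "t \<in> (\<lambda>(a, b). vector [1/3, a, b]) ` (?A \<times> ?A)"
      by (metis (mono_tags, lifting) case_prod_conv image_eqI)
  qed
  then have "card {t \<in> menger_digits. t $ 1 = 1/3}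
      \<le> card ((\<lambda>(a, b). vector [1/3, a, b] :: real^3) ` (?A \<times> ?A))"
    by (intro card_mono) auto
  also have "\<dots> \<le> card (?A \<times> ?A)"
    by (rule card_image_le) simp
  finally show ?thesis by (simp add: card_cartesian_product)
qed

section \<open>Counting the cubes that meet a plane of fixed first coordinate\<close>

definition words_over :: "real \<Rightarrow> nat \<Rightarrow> (real^3) list set" where
  "words_over x N = {w. length w = N \<and> set w \<subseteq> menger_digits \<and>
     x \<in> proj_100 ` menger_word_map w ` cbox 0 1}"

lemma finite_words_over: "finite (words_over x N)"
  by (rule finite_subset[OF _ finite_lists_length_eq[OF finite_menger_digits, of N]])
     (auto simp: words_over_def)

lemma card_words_over_0_le: "card (words_over x 0) \<le> 1"
proof -
  have "words_over x 0 \<subseteq> {[]}" by (auto simp: words_over_def)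
  from card_mono[OF _ this] show ?thesis by simp
qed

text \<open>Dropping the first letter \<open>t\<close> undoes \<open>menger_map t\<close>, whose
  inverse acts on the first coordinate as y -> 3y - 3t_1. This turns counting over x into a
  recursion along this expanding map.\<close>

lemma words_over_Suc_subset:
  "words_over x (Suc N) \<subseteq> (\<Union>t\<in>menger_digits. (#) t ` words_over (3 * x - 3 * t $ 1) N)"
proof
  fix w assume w: "w \<in> words_over x (Suc N)"
  then obtain t v where tv: "w = t # v"
    by (cases w) (auto simp: words_over_def)
  from w obtain z where z: "z \<in> cbox 0 1" "x = proj_100 (menger_word_map (t # v) z)"
    by (auto simp: words_over_def tv)
  then have "3 * x - 3 * t $ 1 = proj_100 (menger_word_map v z)"
    by (simp add: menger_word_map_def menger_map_def proj_100_def)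
  with z w show "w \<in> (\<Union>t\<in>menger_digits. (#) t ` words_over (3 * x - 3 * t $ 1) N)"
    by (auto simp: words_over_def tv)
qed

lemma menger_digit_1: "t \<in> menger_digits \<Longrightarrow> t $ 1 = 0 \<or> t $ 1 = 1/3 \<or> t $ 1 = 2/3"
  by (auto simp: menger_digits_def)

text \<open>Each digit map sends [0,1] into itself on the first coordinate. The contrapositive is
  what prunes the recursion: a point outside [0,1] has no words over it.\<close>

lemma words_over_nonempty_imp: "w \<in> words_over x N \<Longrightarrow> 0 \<le> x \<and> x \<le> 1"
proof (induction N arbitrary: x w)
  case 0
  then obtain z :: "real^3" where "z \<in> cbox 0 1" "x = z $ 1"
    by (auto simp: words_over_def menger_word_map_def proj_100_def)
  then show ?case by (auto simp: mem_box_cart)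
next
  case (Suc N)
  then obtain t v where t: "t \<in> menger_digits" "v \<in> words_over (3 * x - 3 * t $ 1) N"
    using words_over_Suc_subset by blast
  show ?case
    using Suc.IH[OF t(2)] menger_digit_1[OF t(1)] by auto
qed

text \<open>The digit 1/3 fixes the point 1/2 under y -> 3y - 3t_1, while 0 and 2/3 move it to 3/2
  and -1/2, both outside [0,1].\<close>

lemma words_over_half_Suc_subset:
  "words_over (1/2) (Suc N)
     \<subseteq> (\<Union>t\<in>{t \<in> menger_digits. t $ 1 = 1/3}. (#) t ` words_over (1/2) N)"
proof
  fix w assume "w \<in> words_over (1/2) (Suc N)"
  from subsetD[OF words_over_Suc_subset this] obtain t v
    where t: "t \<in> menger_digits" "v \<in> words_over (3 * (1/2) - 3 * t $ 1) N" and w: "w = t # v"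
    by blast
  then have one: "t $ 1 = 1/3"
    using words_over_nonempty_imp[OF t(2)] menger_digit_1[OF t(1)] by linarith
  have "3 * (1/2) - 3 * t $ 1 = 1/2"
    by (simp add: one)
  with t(2) have "v \<in> words_over (1/2) N" by metis
  then show "w \<in> (\<Union>t\<in>{t \<in> menger_digits. t $ 1 = 1/3}. (#) t ` words_over (1/2) N)"
    using t(1) one w by blast
qed

lemma card_UN_Cons_le:
  assumes "finite T" "\<And>t. t \<in> T \<Longrightarrow> finite (W t)"
  shows "card (\<Union>t\<in>T. (#) t ` W t) \<le> (\<Sum>t\<in>T. card (W t))"
proof -
  have "card (\<Union>t\<in>T. (#) t ` W t) \<le> (\<Sum>t\<in>T. card ((#) t ` W t))"
    by (rule card_UN_le[OF assms(1)])
  also have "\<dots> \<le> (\<Sum>t\<in>T. card (W t))"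
    by (intro sum_mono card_image_le assms)
  finally show ?thesis .
qed

lemma card_words_over_half_le: "card (words_over (1/2) N) \<le> 4 ^ N"
proof (induction N)
  case 0
  show ?case using card_words_over_0_le[of "1/2"] by simp
next
  case (Suc N)
  let ?T = "{t \<in> menger_digits. t $ 1 = 1/3}"
  have "card (words_over (1/2) (Suc N)) \<le> card (\<Union>t\<in>?T. (#) t ` words_over (1/2) N)"
    by (intro card_mono words_over_half_Suc_subset)
       (auto intro: finite_words_over simp: finite_menger_digits)
  also have "\<dots> \<le> (\<Sum>t\<in>?T. card (words_over (1/2) N))"
    by (intro card_UN_Cons_le finite_words_over) (simp add: finite_menger_digits)
  also have "\<dots> \<le> 4 * 4 ^ N"
    using mult_mono[OF card_middle_digits_le Suc.IH] by simp
  finally show ?case by simp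
qed

text \<open>Each step of the recursion lowers the exponent n by one, so after n letters the point is
  a half-integer: either 1/2, with at most 4^N words, or outside [0,1], with none. The first n
  letters affect only the constant C.\<close>

lemma card_words_over_le:
  "\<exists>C. \<forall>N. card (words_over ((of_int k + 1/2) / 3 ^ n) N) \<le> C * 4 ^ N"
proof (induction n arbitrary: k)
  case 0
  show ?case
  proof (cases "k = 0")
    case True
    then show ?thesis
      using card_words_over_half_le by (intro exI[of _ 1]) simp
  next
    case False
    then have "\<not> (0 \<le> real_of_int k + 1/2 \<and> real_of_int k + 1/2 \<le> 1)"
      by linarith
    then have "words_over (of_int k + 1/2) N = {}" for N
      using words_over_nonempty_imp by blast
    then show ?thesis by (intro exI[of _ 0]) simp
  qed
next
  case (Suc n)
  let ?x = "(of_int k + 1/2) / 3 ^ Suc n :: real"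
  have "\<exists>C. \<forall>N. card (words_over (3 * ?x - 3 * t $ 1) N) \<le> C * 4 ^ N"
    if "t \<in> menger_digits" for t :: "real^3"
  proof -
    \<comment> \<open>Tripled digits are integers, so the new point again has a numerator of the
      form integer + 1/2.\<close>
    have "3 * t $ 1 = of_int 0 \<or> 3 * t $ 1 = of_int 1 \<or> 3 * t $ 1 = of_int 2"
      using menger_digit_1[OF that] by auto
    then obtain j :: int where j: "3 * t $ 1 = of_int j" by blast
    have "3 * ?x - 3 * t $ 1 = (of_int (k - j * 3 ^ n) + 1/2) / 3 ^ n"
      unfolding j by (simp add: field_simps)
    then show ?thesis
      using Suc.IH[of "k - j * 3 ^ n"] by simp
  qed
  then obtain C where C:
    "card (words_over (3 * ?x - 3 * t $ 1) N) \<le> C t * 4 ^ N" if "t \<in> menger_digits" for t N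
    by metis
  let ?D = "\<Sum>t\<in>menger_digits. C t"
  \<comment> \<open>The summand 1 accounts for the empty word at level 0, since nothing bounds
    \<open>?D\<close> from below by 1.\<close>
  have "card (words_over ?x N) \<le> (1 + ?D) * 4 ^ N" for N
  proof (cases N)
    case 0
    show ?thesis using card_words_over_0_le[of ?x] by (simp add: 0)
  next
    case (Suc m)
    have "card (words_over ?x (Suc m))
        \<le> card (\<Union>t\<in>menger_digits. (#) t ` words_over (3 * ?x - 3 * t $ 1) m)"
      by (intro card_mono words_over_Suc_subset)
         (auto intro: finite_words_over simp: finite_menger_digits)
    also have "\<dots> \<le> (\<Sum>t\<in>menger_digits. card (words_over (3 * ?x - 3 * t $ 1) m))"
      by (intro card_UN_Cons_le finite_words_over finite_menger_digits)
    also have "\<dots> \<le> ?D * 4 ^ m"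
      unfolding sum_distrib_right by (intro sum_mono C)
    also have "\<dots> \<le> (1 + ?D) * 4 ^ Suc m"
      by (intro mult_mono) auto
    finally show ?thesis by (simp only: Suc)
  qed
  then show ?case by blast
qed

section \<open>Retention probabilities and the first-moment bound\<close>

lemma proj_menger_spongeD:
  assumes "x \<in> proj_100 ` menger_sponge L" and "N \<ge> 1"
  shows "\<exists>w\<in>words_over x N. \<forall>k\<in>{1..N}. L (take k w)"
proof -
  from assms obtain v where v: "v \<in> menger_sponge L" "x = proj_100 v"
    by blast
  then obtain w where "w \<in> retained_words L N" "v \<in> menger_word_map w ` cbox 0 1"
    using assms(2) unfolding menger_sponge_def by blast
  with v(2) show ?thesis
    by (intro bexI[of _ w]) (auto simp: retained_words_def words_over_def)
qed

text \<open>The nonempty prefixes of \<open>w\<close> are pairwise distinct words, so their labels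
  are independent and each contributes one factor \<open>p\<close>.\<close>

lemma (in prob_space)
  assumes indep: "indep_vars (\<lambda>_. count_space UNIV) X menger_words"
    and distr: "\<And>w. w \<in> menger_words \<Longrightarrow>
           distr M (count_space UNIV) (X w) = measure_pmf (bernoulli_pmf p)"
    and p: "0 \<le> p" "p \<le> 1"
    and w: "set w \<subseteq> menger_digits" "w \<noteq> []"
  shows retained_event: "{\<omega> \<in> space M. \<forall>k\<in>{1..length w}. X (take k w) \<omega>} \<in> events"
    and prob_retained: "prob {\<omega> \<in> space M. \<forall>k\<in>{1..length w}. X (take k w) \<omega>} = p ^ length w"
proof -
  let ?J = "(\<lambda>k. take k w) ` {1..length w}"
  have J: "?J \<subseteq> menger_words"
    using w by (auto simp: menger_words_def dest: in_set_takeD)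
  have inj: "inj_on (\<lambda>k. take k w) {1..length w}"
    by (rule inj_on_inverseI[where g = length]) auto
  have meas: "X v \<in> M \<rightarrow>\<^sub>M count_space UNIV" if "v \<in> menger_words" for v
    using indep that by (simp add: indep_vars_def)
  have single: "prob (X v -` {True} \<inter> space M) = p" if v: "v \<in> menger_words" for v
  proof -
    have "prob (X v -` {True} \<inter> space M) = measure (distr M (count_space UNIV) (X v)) {True}"
      by (rule measure_distr[symmetric, OF meas[OF v]]) simp
    also have "\<dots> = pmf (bernoulli_pmf p) True"
      unfolding distr[OF v] by (rule measure_pmf_single)
    finally show ?thesis using p by simp
  qed
  have eq: "{\<omega> \<in> space M. \<forall>k\<in>{1..length w}. X (take k w) \<omega>}
      = (\<Inter>v\<in>?J. X v -` {True} \<inter> space M)"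
    using w(2) by (force simp: neq_Nil_conv)
  \<comment> \<open>Over an empty index set the intersection would be \<open>UNIV\<close> rather
    than \<open>space M\<close>.\<close>
  have "?J \<noteq> {}" using w(2) by (simp add: Suc_le_eq)
  then have "prob (\<Inter>v\<in>?J. X v -` {True} \<inter> space M) = (\<Prod>v\<in>?J. prob (X v -` {True} \<inter> space M))"
    using J by (intro indep_varsD[OF indep]) auto
  also have "\<dots> = p ^ length w"
    using J inj by (subst prod.reindex) (auto simp: single image_subset_iff)
  finally show "prob {\<omega> \<in> space M. \<forall>k\<in>{1..length w}. X (take k w) \<omega>} = p ^ length w"
    unfolding eq .
  show "{\<omega> \<in> space M. \<forall>k\<in>{1..length w}. X (take k w) \<omega>} \<in> events"
    unfolding eq using J \<open>?J \<noteq> {}\<close>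
    by (intro sets.finite_INT) (auto intro!: measurable_sets[OF meas])
qed

lemma (in prob_space) AE_not_in_proj_menger_sponge:
  assumes indep: "indep_vars (\<lambda>_. count_space UNIV) X menger_words"
    and distr: "\<And>w. w \<in> menger_words \<Longrightarrow>
           distr M (count_space UNIV) (X w) = measure_pmf (bernoulli_pmf p)"
    and p: "0 \<le> p" "p < 1/4"
  shows "AE \<omega> in M. (of_int k + 1/2) / 3 ^ n \<notin> proj_100 ` menger_sponge (\<lambda>w. X w \<omega>)"
proof -
  define x :: real where "x = (of_int k + 1/2) / 3 ^ n"
  obtain C where C: "\<And>N. card (words_over x N) \<le> C * 4 ^ N"
    using card_words_over_le unfolding x_def by blast
  define E where "E w = {\<omega> \<in> space M. \<forall>k\<in>{1..length w}. X (take k w) \<omega>}" for w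
  \<comment> \<open>The shift to \<open>Suc N\<close> is there because the sponge intersects levels
    from 1 on.\<close>
  define B where "B N = (\<Union>w\<in>words_over x (Suc N). E w)" for N
  have E: "E w \<in> events" "prob (E w) = p ^ Suc N" if "w \<in> words_over x (Suc N)" for w N
  proof -
    have "set w \<subseteq> menger_digits" "w \<noteq> []" "length w = Suc N"
      using that by (auto simp: words_over_def)
    then show "E w \<in> events" "prob (E w) = p ^ Suc N"
      unfolding E_def
      using retained_event[OF indep distr, of w] prob_retained[OF indep distr, of w] p by auto
  qed
  have B: "B N \<in> events" for N
    unfolding B_def using E finite_words_over by (intro sets.finite_UN) auto
  have B_le: "prob (B N) \<le> C * (4 * p) ^ Suc N" for N
  proof -
    have "prob (B N) \<le> (\<Sum>w\<in>words_over x (Suc N). prob (E w))"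
      unfolding B_def using E finite_words_over
      by (intro finite_measure_subadditive_finite) auto
    also have "\<dots> = card (words_over x (Suc N)) * p ^ Suc N"
      by (simp add: E)
    also have "\<dots> \<le> real (C * 4 ^ Suc N) * p ^ Suc N"
      using p by (intro mult_right_mono of_nat_mono C zero_le_power)
    finally show ?thesis by (simp add: power_mult_distrib mult_ac)
  qed
  have "(\<lambda>N. C * (4 * p) ^ Suc N) \<longlonglongrightarrow> 0"
    using p by (intro tendsto_mult_right_zero LIMSEQ_Suc LIMSEQ_power_zero) auto
  \<comment> \<open>The intersection lies in every \<open>B N\<close>, so its probability is below
    all the bounds and hence below their limit 0.\<close>
  moreover have "prob (\<Inter>N. B N) \<le> C * (4 * p) ^ Suc N" for N
    using B_le[of N] finite_measure_mono[OF _ B, of "\<Inter>N. B N" N] by force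
  ultimately have "prob (\<Inter>N. B N) \<le> 0"
    by (intro LIMSEQ_le_const) auto
  then have "prob (\<Inter>N. B N) = 0"
    by (simp add: measure_le_0_iff)
  moreover have "(\<Inter>N. B N) \<in> events"
    using B by auto
  ultimately have null: "(\<Inter>N. B N) \<in> null_sets M"
    by (simp add: null_sets_def emeasure_eq_measure)
  have "\<omega> \<in> B N" if "\<omega> \<in> space M" "x \<in> proj_100 ` menger_sponge (\<lambda>w. X w \<omega>)" for \<omega> N
    using proj_menger_spongeD[OF that(2), of "Suc N"] that(1)
    by (fastforce simp: B_def E_def words_over_def)
  \<comment> \<open>This event is not itself shown to be measurable; its inclusion in a measurable
    null set yields the almost sure statement.\<close>
  then have "{\<omega> \<in> space M. \<not> x \<notin> proj_100 ` menger_sponge (\<lambda>w. X w \<omega>)} \<subseteq> (\<Inter>N. B N)"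
    by auto
  from AE_I'[OF null this] show ?thesis
    unfolding x_def .
qed

section \<open>Density of the ternary midpoints and the conclusion\<close>

lemma ternary_midpoint_between:
  fixes a b :: real
  assumes "a < b"
  shows "\<exists>(k::int) n. a < (of_int k + 1/2) / 3 ^ n \<and> (of_int k + 1/2) / 3 ^ n < b"
proof -
  \<comment> \<open>Scaled by 3^n, the interval becomes longer than 2, which leaves room for a
    half-integer.\<close>
  obtain n where n: "2 / (b - a) < 3 ^ n"
    using real_arch_pow[of 3 "2 / (b - a)"] by auto
  then have ab: "a * 3 ^ n + 2 < b * 3 ^ n"
    using assms by (simp add: field_simps)
  \<comment> \<open>This integer lies above a * 3^n by at most 1, so k + 1/2 exceeds a * 3^n by at
    most 3/2.\<close>
  define k where "k = \<lfloor>a * 3 ^ n\<rfloor> + 1"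
  have "a * 3 ^ n < of_int k + 1/2" "of_int k + 1/2 < b * 3 ^ n"
    using ab unfolding k_def by linarith+
  then show ?thesis
    by (intro exI[of _ k] exI[of _ n]) (simp add: field_simps)
qed

theorem theorem1p17:
  fixes p :: real and M :: "'a measure" and X :: "(real^3) list \<Rightarrow> 'a \<Rightarrow> bool"
  assumes "0 < p" and "p < 1"
    and "prob_space M"
    and "prob_space.indep_vars M (\<lambda>_. count_space UNIV) X menger_words"
    and "\<And>w. w \<in> menger_words \<Longrightarrow>
           distr M (count_space UNIV) (X w) = measure_pmf (bernoulli_pmf p)"
    and "p < 0.25"
  shows "AE \<omega> in M. \<not> (\<exists>I. nondegenerate_interval I \<and>
           I \<subseteq> proj_100 ` menger_sponge (\<lambda>w. X w \<omega>))"
proof -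
  \<comment> \<open>There are countably many pairs (k, n), so one null set serves all midpoints at
    once.\<close>
  have "AE \<omega> in M. \<forall>(k::int) n.
      (of_int k + 1/2) / 3 ^ n \<notin> proj_100 ` menger_sponge (\<lambda>w. X w \<omega>)"
    unfolding AE_all_countable
    using prob_space.AE_not_in_proj_menger_sponge[OF assms(3-5)] assms(1,6) by simp
  then show ?thesis
  proof (rule eventually_mono)
    fix \<omega>
    let ?P = "proj_100 ` menger_sponge (\<lambda>w. X w \<omega>)"
    assume avoid: "\<forall>(k::int) n. (of_int k + 1/2) / 3 ^ n \<notin> ?P"
    show "\<not> (\<exists>I. nondegenerate_interval I \<and> I \<subseteq> ?P)"
    proof clarify
      fix I assume I: "nondegenerate_interval I" "I \<subseteq> ?P"
      then obtain a b where ab: "a \<in> I" "b \<in> I" "a < b" and int: "is_interval I"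
        unfolding nondegenerate_interval_def by (metis neqE)
      obtain k :: int and n where
        "a < (of_int k + 1/2) / 3 ^ n" "(of_int k + 1/2) / 3 ^ n < b"
        using ternary_midpoint_between[OF ab(3)] by blast
      then have "(of_int k + 1/2) / 3 ^ n \<in> I"
        using int ab unfolding is_interval_1 by (meson less_imp_le)
      with I(2) avoid show False by blast
    qed
  qed
qed

end
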